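(* Let $M,K\ge 1$ and let $I_1,I_2,\dots$ be positive integers. Let $\mathcal{A}\in\mathbb{C}^{I_1\times\cdots\times I_M\times I_1\times\cdots\times I_M}$ and $\mathcal{B}\in\mathbb{C}^{I_1\times\cdots\times I_K\times I_1\times\cdots\times I_K}$ be invertible tensors, and let $\mathcal{U}\in\mathbb{C}^{I_1\times\cdots\times I_M\times I_1\times\cdots\times I_K}$ and $\mathcal{V}\in\mathbb{C}^{I_1\times\cdots\times I_K\times I_1\times\cdots\times I_M}$ be tensors. If the tensor $\mathcal{B}^{-1}+\mathcal{V}\star_M\mathcal{A}^{-1}\star_M\mathcal{U}$ is invertible, then $\mathcal{A}+\mathcal{U}\star_K\mathcal{B}\star_K\mathcal{V}$ is invertible and $$(\mathcal{A}+\mathcal{U}\star_K\mathcal{B}\star_K\mathcal{V})^{-1}=\mathcal{A}^{-1}-\mathcal{A}^{-1}\star_M\mathcal{U}\star_K(\mathcal{B}^{-1}+\mathcal{V}\star_M\mathcal{A}^{-1}\star_M\mathcal{U})^{-1}\star_K\mathcal{V}\star_M\mathcal{A}^{-1}.$$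
   Context: $\mathbb{C}^{I_1\times\cdots\times I_M\times J_1\times\cdots\times J_N}$ is the set of complex arrays $\mathcal{A}=(a_{i_1,\dots,i_M,j_1,\dots,j_N})$ with $1\le i_k\le I_k$, $1\le j_k\le J_k$; addition is entrywise. For $\mathcal{A}\in\mathbb{C}^{I_1\times\cdots\times I_M\times J_1\times\cdots\times J_N}$ and $\mathcal{B}\in\mathbb{C}^{J_1\times\cdots\times J_N\times K_1\times\cdots\times K_L}$ the Einstein product $\mathcal{A}\star_N\mathcal{B}\in\mathbb{C}^{I_1\times\cdots\times I_M\times K_1\times\cdots\times K_L}$ is $$(\mathcal{A}\star_N\mathcal{B})_{i_1,\dots,i_M,k_1,\dots,k_L}=\sum_{j_1,\dots,j_N}a_{i_1,\dots,i_M,j_1,\dots,j_N}\,b_{j_1,\dots,j_N,k_1,\dots,k_L}.$$ The identity tensor $\mathcal{I}\in\mathbb{C}^{I_1\times\cdots\times I_M\times I_1\times\cdots\times I_M}$ has entries $\prod_{k=1}^M\delta_{i_k,j_k}$. A tensor $\mathcal{A}\in\mathbb{C}^{I_1\times\cdots\times I_M\times I_1\times\cdots\times I_M}$ is invertible, with inverse $\mathcal{A}^{-1}=\mathcal{X}$, if there is $\mathcal{X}$ of the same size with $\mathcal{A}\star_M\mathcal{X}=\mathcal{X}\star_M\mathcal{A}=\mathcal{I}$. *)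

theory Defs
  imports Complex_Main
begin

definition multi_indices :: "nat list \<Rightarrow> nat list set" where
  "multi_indices ds = {ix. list_all2 (\<lambda>i d. 1 \<le> i \<and> i \<le> d) ix ds}"

text \<open>A complex array is its list of dimensions together with its entries, as a function of the
  index tuple. The entries are 0 at every list that is not a valid index tuple, so that two arrays
  are equal iff they have the same dimensions and the same entries.\<close>

typedef ctensor =
  "{(ds, f) :: nat list \<times> (nat list \<Rightarrow> complex) | ds f. \<forall>ix. ix \<notin> multi_indices ds \<longrightarrow> f ix = 0}"
  by (rule exI[of _ "([], \<lambda>_. 0)"]) simp

definition dims :: "ctensor \<Rightarrow> nat list" where
  "dims A = fst (Rep_ctensor A)"

definition entry :: "ctensor \<Rightarrow> nat list \<Rightarrow> complex" where
  "entry A = snd (Rep_ctensor A)"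

definition tensor_of :: "nat list \<Rightarrow> (nat list \<Rightarrow> complex) \<Rightarrow> ctensor" where
  "tensor_of ds f = Abs_ctensor (ds, \<lambda>ix. if ix \<in> multi_indices ds then f ix else 0)"

lemma Rep_tensor_of:
  "Rep_ctensor (tensor_of ds f) = (ds, \<lambda>ix. if ix \<in> multi_indices ds then f ix else 0)"
  unfolding tensor_of_def by (rule Abs_ctensor_inverse) simp

lemma dims_tensor_of [simp]: "dims (tensor_of ds f) = ds"
  by (simp add: dims_def Rep_tensor_of)

lemma entry_tensor_of [simp]: "ix \<in> multi_indices ds \<Longrightarrow> entry (tensor_of ds f) ix = f ix"
  by (simp add: entry_def Rep_tensor_of)

lemma entry_outside: "ix \<notin> multi_indices (dims A) \<Longrightarrow> entry A ix = 0"
  using Rep_ctensor[of A] by (auto simp: dims_def entry_def)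

lemma ctensor_eqI:
  assumes "dims A = dims B"
    and "\<And>ix. ix \<in> multi_indices (dims A) \<Longrightarrow> entry A ix = entry B ix"
  shows "A = B"
proof -
  have "entry A = entry B"
    using assms entry_outside by (metis ext)
  with assms(1) have "Rep_ctensor A = Rep_ctensor B"
    by (simp add: dims_def entry_def prod_eq_iff)
  then show ?thesis
    by (simp add: Rep_ctensor_inject)
qed

definition tensor_space :: "nat list \<Rightarrow> ctensor set" where
  "tensor_space ds = {A. dims A = ds}"

text \<open>Sum and difference are meaningful only for arrays of the same dimensions.\<close>

instantiation ctensor :: "{plus, minus}"
begin

definition plus_ctensor :: "ctensor \<Rightarrow> ctensor \<Rightarrow> ctensor" where
  "A + B = tensor_of (dims A) (\<lambda>ix. entry A ix + entry B ix)"

definition minus_ctensor :: "ctensor \<Rightarrow> ctensor \<Rightarrow> ctensor" where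
  "A - B = tensor_of (dims A) (\<lambda>ix. entry A ix - entry B ix)"

instance ..

end

text \<open>The product contracts the last \<open>N\<close> modes of \<open>A\<close> with the first \<open>N\<close> modes of \<open>B\<close>; it is
  meaningful only if the dimensions of these modes agree. The lemmas below give its dimensions and
  its entries in that case.\<close>

definition einstein_prod :: "ctensor \<Rightarrow> nat \<Rightarrow> ctensor \<Rightarrow> ctensor"
    (\<open>_ \<star>\<^bsub>_\<^esub> _\<close> [70, 0, 71] 70) where
  "A \<star>\<^bsub>N\<^esub> B =
    (let M = length (dims A) - N in
      tensor_of (take M (dims A) @ drop N (dims B))
        (\<lambda>ix. \<Sum>j\<in>multi_indices (take N (dims B)).
           entry A (take M ix @ j) * entry B (j @ drop M ix)))"

lemma dims_einstein_prod:
  assumes "A \<in> tensor_space (Is @ Js)" and "B \<in> tensor_space (Js @ Ks)"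
  shows "A \<star>\<^bsub>length Js\<^esub> B \<in> tensor_space (Is @ Ks)"
  using assms by (simp add: tensor_space_def einstein_prod_def Let_def)

lemma entry_einstein_prod:
  assumes "A \<in> tensor_space (Is @ Js)" and "B \<in> tensor_space (Js @ Ks)"
    and "i \<in> multi_indices Is" and "k \<in> multi_indices Ks"
  shows "entry (A \<star>\<^bsub>length Js\<^esub> B) (i @ k) =
    (\<Sum>j\<in>multi_indices Js. entry A (i @ j) * entry B (j @ k))"
proof -
  have "length i = length Is"
    using assms(3) by (auto simp: multi_indices_def dest: list_all2_lengthD)
  moreover have "i @ k \<in> multi_indices (Is @ Ks)"
    using assms(3,4) by (auto simp: multi_indices_def intro: list_all2_appendI)
  ultimately show ?thesis
    using assms(1,2) by (simp add: tensor_space_def einstein_prod_def Let_def)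
qed

definition identity_tensor :: "nat list \<Rightarrow> ctensor" where
  "identity_tensor Is = tensor_of (Is @ Is)
    (\<lambda>ix. \<Prod>k<length Is. if ix ! k = ix ! (length Is + k) then 1 else 0)"

definition is_inverse_tensor :: "ctensor \<Rightarrow> ctensor \<Rightarrow> bool" where
  "is_inverse_tensor A X \<longleftrightarrow>
    (\<exists>Is. A \<in> tensor_space (Is @ Is) \<and> X \<in> tensor_space (Is @ Is) \<and>
      A \<star>\<^bsub>length Is\<^esub> X = identity_tensor Is \<and> X \<star>\<^bsub>length Is\<^esub> A = identity_tensor Is)"

definition invertible_tensor :: "ctensor \<Rightarrow> bool" where
  "invertible_tensor A \<longleftrightarrow> (\<exists>X. is_inverse_tensor A X)"

definition inverse_tensor :: "ctensor \<Rightarrow> ctensor" where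
  "inverse_tensor A = (THE X. is_inverse_tensor A X)"

definition dims_upto :: "(nat \<Rightarrow> nat) \<Rightarrow> nat \<Rightarrow> nat list" where
  "dims_upto I M = map I [1..<Suc M]"

end

theory Submission
  imports Defs
begin

text \<open>
  Grouping the first and the last modes turns tensors of dimensions \<open>Is @ Js\<close> into matrices whose
  rows are labelled by the index tuples of \<open>Is\<close> and whose columns by those of \<open>Js\<close>, and the Einstein
  product into the matrix product. The product is therefore associative and bilinear, has the
  identity tensors as units, and the claim becomes the Sherman--Morrison--Woodbury identity, which
  needs only these laws.

  Write \<open>W = A + UBV\<close>, \<open>S = B\<^sup>-\<^sup>1 + VA\<^sup>-\<^sup>1U\<close> and \<open>X = A\<^sup>-\<^sup>1 - A\<^sup>-\<^sup>1US\<^sup>-\<^sup>1VA\<^sup>-\<^sup>1\<close>. Everything rests on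
  the exchange rules \<open>WA\<^sup>-\<^sup>1U = U + UBVA\<^sup>-\<^sup>1U = UBS\<close> and \<open>VA\<^sup>-\<^sup>1W = V + VA\<^sup>-\<^sup>1UBV = SBV\<close>. By the first,
  \<open>WX = WA\<^sup>-\<^sup>1 - UBSS\<^sup>-\<^sup>1VA\<^sup>-\<^sup>1 = (1 + UBVA\<^sup>-\<^sup>1) - UBVA\<^sup>-\<^sup>1 = 1\<close>; by the second, \<open>XW = 1\<close> in the same way
  (\<open>woodbury_right\<close>, \<open>woodbury_left\<close>). Inverses are unique because the product is associative, so
  \<open>X\<close> is the inverse of \<open>W\<close>.
\<close>

section \<open>Index tuples\<close>

lemma multi_indices_append_iff:
  "ix \<in> multi_indices (Is @ Js) \<longleftrightarrow>
    (\<exists>i\<in>multi_indices Is. \<exists>j\<in>multi_indices Js. ix = i @ j)"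
  by (auto simp: multi_indices_def list_all2_append2 dest: list_all2_lengthD
      intro: list_all2_appendI)

lemma finite_multi_indices: "finite (multi_indices ds)"
proof (induction ds)
  case Nil
  then show ?case by (simp add: multi_indices_def)
next
  case (Cons d ds)
  have "multi_indices (d # ds) = (\<lambda>(i, ix). i # ix) ` ({1..d} \<times> multi_indices ds)"
    by (auto simp: multi_indices_def list_all2_Cons2 image_iff)
  with Cons show ?case by simp
qed

lemma length_multi_index: "ix \<in> multi_indices ds \<Longrightarrow> length ix = length ds"
  by (auto simp: multi_indices_def dest: list_all2_lengthD)

section \<open>Tensors as matrices\<close>

lemma tensor_space_eqI:
  assumes "A \<in> tensor_space (Is @ Js)" and "B \<in> tensor_space (Is @ Js)"
    and "\<And>i j. i \<in> multi_indices Is \<Longrightarrow> j \<in> multi_indices Js \<Longrightarrow>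
      entry A (i @ j) = entry B (i @ j)"
  shows "A = B"
  using assms by (intro ctensor_eqI) (auto simp: tensor_space_def multi_indices_append_iff)

lemma plus_in_tensor_space: "A \<in> tensor_space ds \<Longrightarrow> A + B \<in> tensor_space ds"
  by (simp add: tensor_space_def plus_ctensor_def)

lemma minus_in_tensor_space: "A \<in> tensor_space ds \<Longrightarrow> A - B \<in> tensor_space ds"
  by (simp add: tensor_space_def minus_ctensor_def)

lemma identity_in_tensor_space: "identity_tensor Is \<in> tensor_space (Is @ Is)"
  by (simp add: tensor_space_def identity_tensor_def)

lemmas tensor_space_closed =
  dims_einstein_prod plus_in_tensor_space minus_in_tensor_space identity_in_tensor_space

lemma entry_plus:
  assumes "A \<in> tensor_space (Is @ Js)" "i \<in> multi_indices Is" "j \<in> multi_indices Js"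
  shows "entry (A + B) (i @ j) = entry A (i @ j) + entry B (i @ j)"
proof -
  have "i @ j \<in> multi_indices (Is @ Js)"
    using assms by (auto simp: multi_indices_append_iff)
  with assms(1) show ?thesis
    by (simp add: tensor_space_def plus_ctensor_def)
qed

lemma entry_minus:
  assumes "A \<in> tensor_space (Is @ Js)" "i \<in> multi_indices Is" "j \<in> multi_indices Js"
  shows "entry (A - B) (i @ j) = entry A (i @ j) - entry B (i @ j)"
proof -
  have "i @ j \<in> multi_indices (Is @ Js)"
    using assms by (auto simp: multi_indices_append_iff)
  with assms(1) show ?thesis
    by (simp add: tensor_space_def minus_ctensor_def)
qed

lemma entry_identity_tensor:
  assumes "i \<in> multi_indices Is" and "j \<in> multi_indices Is"
  shows "entry (identity_tensor Is) (i @ j) = (if i = j then 1 else 0)"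
proof -
  have "i @ j \<in> multi_indices (Is @ Is)"
    using assms by (auto simp: multi_indices_append_iff)
  moreover have len: "length i = length Is" "length j = length Is"
    using assms by (simp_all add: length_multi_index)
  ultimately have "entry (identity_tensor Is) (i @ j) =
      (\<Prod>k<length Is. if i ! k = j ! k then 1 else 0)"
    by (auto simp: identity_tensor_def nth_append intro!: prod.cong)
  also have "\<dots> = (if i = j then 1 else 0)"
  proof (cases "i = j")
    case False
    then obtain k where "k < length Is" "i ! k \<noteq> j ! k"
      using len by (metis nth_equalityI)
    then have "(\<Prod>k<length Is. if i ! k = j ! k then 1 else 0 :: complex) = 0"
      by (intro prod_zero) auto
    with False show ?thesis by simp
  qed simp
  finally show ?thesis .
qed

section \<open>The laws of the Einstein product\<close>

lemma einstein_prod_assoc: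
  assumes A: "A \<in> tensor_space (Is @ Js)" and B: "B \<in> tensor_space (Js @ Ks)"
    and C: "C \<in> tensor_space (Ks @ Ls)"
  shows "A \<star>\<^bsub>length Js\<^esub> B \<star>\<^bsub>length Ks\<^esub> C = A \<star>\<^bsub>length Js\<^esub> (B \<star>\<^bsub>length Ks\<^esub> C)"
    (is "?L = ?R")
proof (rule tensor_space_eqI)
  note AB = dims_einstein_prod[OF A B] and BC = dims_einstein_prod[OF B C]
  show "?L \<in> tensor_space (Is @ Ls)" by (rule dims_einstein_prod[OF AB C])
  show "?R \<in> tensor_space (Is @ Ls)" by (rule dims_einstein_prod[OF A BC])
  fix i l assume il: "i \<in> multi_indices Is" "l \<in> multi_indices Ls"
  have "entry ?L (i @ l) = (\<Sum>k\<in>multi_indices Ks. \<Sum>j\<in>multi_indices Js.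
      entry A (i @ j) * entry B (j @ k) * entry C (k @ l))"
    using il by (simp add: entry_einstein_prod[OF AB C] entry_einstein_prod[OF A B]
        sum_distrib_right)
  also have "\<dots> = (\<Sum>j\<in>multi_indices Js. \<Sum>k\<in>multi_indices Ks.
      entry A (i @ j) * entry B (j @ k) * entry C (k @ l))"
    by (rule sum.swap)
  also have "\<dots> = entry ?R (i @ l)"
    using il by (simp add: entry_einstein_prod[OF A BC] entry_einstein_prod[OF B C]
        sum_distrib_left mult.assoc)
  finally show "entry ?L (i @ l) = entry ?R (i @ l)" .
qed

lemma einstein_prod_distrib_left:
  assumes A: "A \<in> tensor_space (Is @ Js)" and B: "B \<in> tensor_space (Js @ Ks)"
    and C: "C \<in> tensor_space (Js @ Ks)"
  shows "A \<star>\<^bsub>length Js\<^esub> (B + C) = A \<star>\<^bsub>length Js\<^esub> B + A \<star>\<^bsub>length Js\<^esub> C"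
    (is "?L = ?R")
proof (rule tensor_space_eqI)
  note S = plus_in_tensor_space[OF B, of C]
  note AB = dims_einstein_prod[OF A B] and AC = dims_einstein_prod[OF A C]
    and AS = dims_einstein_prod[OF A S]
  show "?L \<in> tensor_space (Is @ Ks)" by (rule AS)
  show "?R \<in> tensor_space (Is @ Ks)" by (rule plus_in_tensor_space[OF AB])
  fix i k assume ik: "i \<in> multi_indices Is" "k \<in> multi_indices Ks"
  then show "entry ?L (i @ k) = entry ?R (i @ k)"
    by (simp add: entry_einstein_prod[OF A B] entry_einstein_prod[OF A C]
        entry_einstein_prod[OF A S]
        entry_plus[OF B] entry_plus[OF AB] algebra_simps sum.distrib)
qed

lemma einstein_prod_distrib_right:
  assumes A: "A \<in> tensor_space (Is @ Js)" and B: "B \<in> tensor_space (Is @ Js)"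
    and C: "C \<in> tensor_space (Js @ Ks)"
  shows "(A + B) \<star>\<^bsub>length Js\<^esub> C = A \<star>\<^bsub>length Js\<^esub> C + B \<star>\<^bsub>length Js\<^esub> C"
    (is "?L = ?R")
proof (rule tensor_space_eqI)
  note S = plus_in_tensor_space[OF A, of B]
  note AC = dims_einstein_prod[OF A C] and BC = dims_einstein_prod[OF B C]
    and SC = dims_einstein_prod[OF S C]
  show "?L \<in> tensor_space (Is @ Ks)" by (rule SC)
  show "?R \<in> tensor_space (Is @ Ks)" by (rule plus_in_tensor_space[OF AC])
  fix i k assume ik: "i \<in> multi_indices Is" "k \<in> multi_indices Ks"
  then show "entry ?L (i @ k) = entry ?R (i @ k)"
    by (simp add: entry_einstein_prod[OF A C] entry_einstein_prod[OF B C]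
        entry_einstein_prod[OF S C]
        entry_plus[OF A] entry_plus[OF AC] algebra_simps sum.distrib)
qed

lemma einstein_prod_diff_distrib_left:
  assumes A: "A \<in> tensor_space (Is @ Js)" and B: "B \<in> tensor_space (Js @ Ks)"
    and C: "C \<in> tensor_space (Js @ Ks)"
  shows "A \<star>\<^bsub>length Js\<^esub> (B - C) = A \<star>\<^bsub>length Js\<^esub> B - A \<star>\<^bsub>length Js\<^esub> C"
    (is "?L = ?R")
proof (rule tensor_space_eqI)
  note S = minus_in_tensor_space[OF B, of C]
  note AB = dims_einstein_prod[OF A B] and AC = dims_einstein_prod[OF A C]
    and AS = dims_einstein_prod[OF A S]
  show "?L \<in> tensor_space (Is @ Ks)" by (rule AS)
  show "?R \<in> tensor_space (Is @ Ks)" by (rule minus_in_tensor_space[OF AB])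
  fix i k assume ik: "i \<in> multi_indices Is" "k \<in> multi_indices Ks"
  then show "entry ?L (i @ k) = entry ?R (i @ k)"
    by (simp add: entry_einstein_prod[OF A B] entry_einstein_prod[OF A C]
        entry_einstein_prod[OF A S]
        entry_minus[OF B] entry_minus[OF AB] algebra_simps sum_subtractf)
qed

lemma einstein_prod_diff_distrib_right:
  assumes A: "A \<in> tensor_space (Is @ Js)" and B: "B \<in> tensor_space (Is @ Js)"
    and C: "C \<in> tensor_space (Js @ Ks)"
  shows "(A - B) \<star>\<^bsub>length Js\<^esub> C = A \<star>\<^bsub>length Js\<^esub> C - B \<star>\<^bsub>length Js\<^esub> C"
    (is "?L = ?R")
proof (rule tensor_space_eqI)
  note S = minus_in_tensor_space[OF A, of B]
  note AC = dims_einstein_prod[OF A C] and BC = dims_einstein_prod[OF B C]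
    and SC = dims_einstein_prod[OF S C]
  show "?L \<in> tensor_space (Is @ Ks)" by (rule SC)
  show "?R \<in> tensor_space (Is @ Ks)" by (rule minus_in_tensor_space[OF AC])
  fix i k assume ik: "i \<in> multi_indices Is" "k \<in> multi_indices Ks"
  then show "entry ?L (i @ k) = entry ?R (i @ k)"
    by (simp add: entry_einstein_prod[OF A C] entry_einstein_prod[OF B C]
        entry_einstein_prod[OF S C]
        entry_minus[OF A] entry_minus[OF AC] algebra_simps sum_subtractf)
qed

lemma einstein_prod_identity_left:
  assumes A: "A \<in> tensor_space (Is @ Js)"
  shows "identity_tensor Is \<star>\<^bsub>length Is\<^esub> A = A" (is "?L = A")
proof (rule tensor_space_eqI)
  show "?L \<in> tensor_space (Is @ Js)"
    by (rule dims_einstein_prod[OF identity_in_tensor_space A])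
  fix i j assume "i \<in> multi_indices Is" "j \<in> multi_indices Js"
  then show "entry ?L (i @ j) = entry A (i @ j)"
    by (simp add: entry_einstein_prod[OF identity_in_tensor_space A] entry_identity_tensor
        if_distrib[of "\<lambda>x. x * _"] finite_multi_indices cong: if_cong)
qed (rule A)

lemma einstein_prod_identity_right:
  assumes A: "A \<in> tensor_space (Is @ Js)"
  shows "A \<star>\<^bsub>length Js\<^esub> identity_tensor Js = A" (is "?L = A")
proof (rule tensor_space_eqI)
  show "?L \<in> tensor_space (Is @ Js)"
    by (rule dims_einstein_prod[OF A identity_in_tensor_space])
  fix i j assume "i \<in> multi_indices Is" "j \<in> multi_indices Js"
  then show "entry ?L (i @ j) = entry A (i @ j)"
    by (simp add: entry_einstein_prod[OF A identity_in_tensor_space] entry_identity_tensor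
        if_distrib[of "\<lambda>x. _ * x"] finite_multi_indices cong: if_cong)
qed (rule A)

lemma add_diff_cancel_tensor:
  assumes A: "A \<in> tensor_space (Is @ Js)" and B: "B \<in> tensor_space (Is @ Js)"
  shows "A + B - B = A"
proof (rule tensor_space_eqI)
  note S = plus_in_tensor_space[OF A, of B]
  show "A + B - B \<in> tensor_space (Is @ Js)" by (rule minus_in_tensor_space[OF S])
  fix i j assume "i \<in> multi_indices Is" "j \<in> multi_indices Js"
  then show "entry (A + B - B) (i @ j) = entry A (i @ j)"
    by (simp add: entry_minus[OF S] entry_plus[OF A])
qed (rule A)

section \<open>Inverses\<close>

lemma is_inverse_tensor_iff:
  assumes "A \<in> tensor_space (Is @ Is)"
  shows "is_inverse_tensor A X \<longleftrightarrow> X \<in> tensor_space (Is @ Is) \<and>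
    A \<star>\<^bsub>length Is\<^esub> X = identity_tensor Is \<and> X \<star>\<^bsub>length Is\<^esub> A = identity_tensor Is"
proof -
  \<comment> \<open>A dimension list splits into two equal halves in only one way.\<close>
  have "Js = Is" if "A \<in> tensor_space (Js @ Js)" for Js
  proof -
    have eq: "Js @ Js = Is @ Is" using assms that by (simp add: tensor_space_def)
    then have "length (Js @ Js) = length (Is @ Is)" by (rule arg_cong)
    then have "length Js = length Is" by simp
    with eq show ?thesis by simp
  qed
  with assms show ?thesis
    unfolding is_inverse_tensor_def by blast
qed

text \<open>Two inverses coincide by the monoid argument \<open>X = X(AY) = (XA)Y = Y\<close>.\<close>

lemma inverse_tensor_eqI:
  assumes A: "A \<in> tensor_space (Is @ Is)" and X: "is_inverse_tensor A X"
  shows "inverse_tensor A = X"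
  unfolding inverse_tensor_def
proof (rule the_equality)
  fix Y assume "is_inverse_tensor A Y"
  with X A have "X \<in> tensor_space (Is @ Is)" "Y \<in> tensor_space (Is @ Is)"
    "A \<star>\<^bsub>length Is\<^esub> X = identity_tensor Is" "Y \<star>\<^bsub>length Is\<^esub> A = identity_tensor Is"
    by (simp_all add: is_inverse_tensor_iff)
  then show "Y = X"
    using einstein_prod_assoc[of Y Is Is A Is X Is] A
    by (simp add: einstein_prod_identity_left einstein_prod_identity_right)
qed (rule X)

lemma inverse_tensor_props:
  assumes A: "A \<in> tensor_space (Is @ Is)" and "invertible_tensor A"
  shows "inverse_tensor A \<in> tensor_space (Is @ Is)"
    and "A \<star>\<^bsub>length Is\<^esub> inverse_tensor A = identity_tensor Is"
    and "inverse_tensor A \<star>\<^bsub>length Is\<^esub> A = identity_tensor Is"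
proof -
  obtain X where X: "is_inverse_tensor A X"
    using assms(2) by (auto simp: invertible_tensor_def)
  have "is_inverse_tensor A (inverse_tensor A)"
    using inverse_tensor_eqI[OF A X] X by simp
  then show "inverse_tensor A \<in> tensor_space (Is @ Is)"
    and "A \<star>\<^bsub>length Is\<^esub> inverse_tensor A = identity_tensor Is"
    and "inverse_tensor A \<star>\<^bsub>length Is\<^esub> A = identity_tensor Is"
    by (simp_all add: is_inverse_tensor_iff[OF A])
qed

section \<open>The Woodbury identity\<close>

text \<open>The exchange rule \<open>(A + UBV)A'U = UBS\<close>, which uses \<open>AA' = 1\<close> and \<open>BB' = 1\<close>, moves \<open>S\<close> next
  to \<open>S'\<close>, where the two cancel.\<close>

lemma woodbury_right:
  fixes m k :: "nat list" and A A' B B' U V S' :: ctensor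
  defines "S \<equiv> B' + V \<star>\<^bsub>length m\<^esub> A' \<star>\<^bsub>length m\<^esub> U"
  assumes A: "A \<in> tensor_space (m @ m)" and A': "A' \<in> tensor_space (m @ m)"
    and B: "B \<in> tensor_space (k @ k)" and B': "B' \<in> tensor_space (k @ k)"
    and U: "U \<in> tensor_space (m @ k)" and V: "V \<in> tensor_space (k @ m)"
    and S': "S' \<in> tensor_space (k @ k)"
    and AA': "A \<star>\<^bsub>length m\<^esub> A' = identity_tensor m"
    and BB': "B \<star>\<^bsub>length k\<^esub> B' = identity_tensor k"
    and SS': "S \<star>\<^bsub>length k\<^esub> S' = identity_tensor k"
  shows "(A + U \<star>\<^bsub>length k\<^esub> B \<star>\<^bsub>length k\<^esub> V) \<star>\<^bsub>length m\<^esub>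
    (A' - A' \<star>\<^bsub>length m\<^esub> U \<star>\<^bsub>length k\<^esub> S' \<star>\<^bsub>length k\<^esub> V \<star>\<^bsub>length m\<^esub> A') = identity_tensor m"
proof -
  note space = A A' B B' U V S' tensor_space_closed
  define W where "W = A + U \<star>\<^bsub>length k\<^esub> B \<star>\<^bsub>length k\<^esub> V"
  define T where "T = U \<star>\<^bsub>length k\<^esub> B"
  define Y where "Y = T \<star>\<^bsub>length k\<^esub> V \<star>\<^bsub>length m\<^esub> A'"
  have W: "W \<in> tensor_space (m @ m)"
    unfolding W_def by (intro space)
  have T: "T \<in> tensor_space (m @ k)"
    unfolding T_def by (intro space)
  have Y: "Y \<in> tensor_space (m @ m)"
    unfolding Y_def by (intro space T)
  have S: "S \<in> tensor_space (k @ k)"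
    unfolding S_def by (intro space)
  have VA: "V \<star>\<^bsub>length m\<^esub> A' \<in> tensor_space (k @ m)"
    and VAU: "V \<star>\<^bsub>length m\<^esub> A' \<star>\<^bsub>length m\<^esub> U \<in> tensor_space (k @ k)"
    and TV: "T \<star>\<^bsub>length k\<^esub> V \<in> tensor_space (m @ m)"
    and AU: "A' \<star>\<^bsub>length m\<^esub> U \<in> tensor_space (m @ k)"
    and AUS: "A' \<star>\<^bsub>length m\<^esub> U \<star>\<^bsub>length k\<^esub> S' \<in> tensor_space (m @ k)"
    and AUSV: "A' \<star>\<^bsub>length m\<^esub> U \<star>\<^bsub>length k\<^esub> S' \<star>\<^bsub>length k\<^esub> V \<in> tensor_space (m @ m)"
    and AUSVA: "A' \<star>\<^bsub>length m\<^esub> U \<star>\<^bsub>length k\<^esub> S' \<star>\<^bsub>length k\<^esub> V \<star>\<^bsub>length m\<^esub> A' \<in> tensor_space (m @ m)"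
    by (intro space T)+
  have WA: "W \<star>\<^bsub>length m\<^esub> A' = identity_tensor m + Y"
    unfolding W_def Y_def using einstein_prod_distrib_right[OF A TV A']
    by (simp add: AA' T_def)
  have TB': "T \<star>\<^bsub>length k\<^esub> B' = U"
    unfolding T_def einstein_prod_assoc[OF U B B']
    by (simp add: BB' einstein_prod_identity_right[OF U])
  have "Y \<star>\<^bsub>length m\<^esub> U = T \<star>\<^bsub>length k\<^esub> (V \<star>\<^bsub>length m\<^esub> A' \<star>\<^bsub>length m\<^esub> U)"
    unfolding Y_def einstein_prod_assoc[OF T V A'] by (rule einstein_prod_assoc[OF T VA U])
  then have "W \<star>\<^bsub>length m\<^esub> A' \<star>\<^bsub>length m\<^esub> U = T \<star>\<^bsub>length k\<^esub> S"
    unfolding WA einstein_prod_distrib_right[OF identity_in_tensor_space Y U]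
    by (simp add: S_def einstein_prod_distrib_left[OF T B' VAU] TB'
        einstein_prod_identity_left[OF U])
  then have exchange: "W \<star>\<^bsub>length m\<^esub> (A' \<star>\<^bsub>length m\<^esub> U) = T \<star>\<^bsub>length k\<^esub> S"
    by (simp add: einstein_prod_assoc[OF W A' U])
  have "W \<star>\<^bsub>length m\<^esub> (A' \<star>\<^bsub>length m\<^esub> U \<star>\<^bsub>length k\<^esub> S' \<star>\<^bsub>length k\<^esub> V \<star>\<^bsub>length m\<^esub> A')
      = W \<star>\<^bsub>length m\<^esub> (A' \<star>\<^bsub>length m\<^esub> U) \<star>\<^bsub>length k\<^esub> S' \<star>\<^bsub>length k\<^esub> V \<star>\<^bsub>length m\<^esub> A'"
    by (simp only: einstein_prod_assoc[OF W AUSV A'] einstein_prod_assoc[OF W AUS V]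
        einstein_prod_assoc[OF W AU S'])
  also have "\<dots> = Y"
    unfolding exchange einstein_prod_assoc[OF T S S'] SS' Y_def
    by (simp add: einstein_prod_identity_right[OF T])
  finally have "W \<star>\<^bsub>length m\<^esub>
      (A' - A' \<star>\<^bsub>length m\<^esub> U \<star>\<^bsub>length k\<^esub> S' \<star>\<^bsub>length k\<^esub> V \<star>\<^bsub>length m\<^esub> A')
      = identity_tensor m + Y - Y"
    by (simp add: einstein_prod_diff_distrib_left[OF W A' AUSVA] WA)
  then show ?thesis
    by (simp add: add_diff_cancel_tensor[OF identity_in_tensor_space Y] W_def)
qed

text \<open>The mirror image of the previous lemma, with the exchange rule \<open>VA'(A + UBV) = SBV\<close>,
  which uses \<open>A'A = 1\<close> and \<open>B'B = 1\<close>.\<close>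

lemma woodbury_left:
  fixes m k :: "nat list" and A A' B B' U V S' :: ctensor
  defines "S \<equiv> B' + V \<star>\<^bsub>length m\<^esub> A' \<star>\<^bsub>length m\<^esub> U"
  assumes A: "A \<in> tensor_space (m @ m)" and A': "A' \<in> tensor_space (m @ m)"
    and B: "B \<in> tensor_space (k @ k)" and B': "B' \<in> tensor_space (k @ k)"
    and U: "U \<in> tensor_space (m @ k)" and V: "V \<in> tensor_space (k @ m)"
    and S': "S' \<in> tensor_space (k @ k)"
    and A'A: "A' \<star>\<^bsub>length m\<^esub> A = identity_tensor m"
    and B'B: "B' \<star>\<^bsub>length k\<^esub> B = identity_tensor k"
    and S'S: "S' \<star>\<^bsub>length k\<^esub> S = identity_tensor k"
  shows "(A' - A' \<star>\<^bsub>length m\<^esub> U \<star>\<^bsub>length k\<^esub> S' \<star>\<^bsub>length k\<^esub> V \<star>\<^bsub>length m\<^esub> A') \<star>\<^bsub>length m\<^esub>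
    (A + U \<star>\<^bsub>length k\<^esub> B \<star>\<^bsub>length k\<^esub> V) = identity_tensor m"
proof -
  note space = A A' B B' U V S' tensor_space_closed
  define W where "W = A + U \<star>\<^bsub>length k\<^esub> B \<star>\<^bsub>length k\<^esub> V"
  define T where "T = B \<star>\<^bsub>length k\<^esub> V"
  define P where "P = A' \<star>\<^bsub>length m\<^esub> U"
  define Y where "Y = P \<star>\<^bsub>length k\<^esub> T"
  have W: "W \<in> tensor_space (m @ m)"
    unfolding W_def by (intro space)
  have T: "T \<in> tensor_space (k @ m)"
    unfolding T_def by (intro space)
  have P: "P \<in> tensor_space (m @ k)"
    unfolding P_def by (intro space)
  have Y: "Y \<in> tensor_space (m @ m)"
    unfolding Y_def by (intro space T P)
  have S: "S \<in> tensor_space (k @ k)"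
    unfolding S_def by (intro space)
  have VP: "V \<star>\<^bsub>length m\<^esub> P \<in> tensor_space (k @ k)"
    and UT: "U \<star>\<^bsub>length k\<^esub> T \<in> tensor_space (m @ m)"
    and PS: "P \<star>\<^bsub>length k\<^esub> S' \<in> tensor_space (m @ k)"
    and PSV: "P \<star>\<^bsub>length k\<^esub> S' \<star>\<^bsub>length k\<^esub> V \<in> tensor_space (m @ m)"
    and PSVA: "P \<star>\<^bsub>length k\<^esub> S' \<star>\<^bsub>length k\<^esub> V \<star>\<^bsub>length m\<^esub> A' \<in> tensor_space (m @ m)"
    by (intro space T P)+
  have W_eq: "W = A + U \<star>\<^bsub>length k\<^esub> T"
    by (simp add: W_def T_def einstein_prod_assoc[OF U B V])
  have S_eq: "S = B' + V \<star>\<^bsub>length m\<^esub> P"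
    by (simp add: S_def P_def einstein_prod_assoc[OF V A' U])
  have AW: "A' \<star>\<^bsub>length m\<^esub> W = identity_tensor m + Y"
    unfolding W_eq einstein_prod_distrib_left[OF A' A UT]
    by (simp add: A'A Y_def P_def einstein_prod_assoc[OF A' U T])
  have B'T: "B' \<star>\<^bsub>length k\<^esub> T = V"
    unfolding T_def einstein_prod_assoc[OF B' B V, symmetric]
    by (simp add: B'B einstein_prod_identity_left[OF V])
  have exchange: "V \<star>\<^bsub>length m\<^esub> (A' \<star>\<^bsub>length m\<^esub> W) = S \<star>\<^bsub>length k\<^esub> T"
    unfolding AW S_eq einstein_prod_distrib_left[OF V identity_in_tensor_space Y]
      einstein_prod_distrib_right[OF B' VP T]
    by (simp add: B'T Y_def einstein_prod_identity_right[OF V] einstein_prod_assoc[OF V P T])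
  have "P \<star>\<^bsub>length k\<^esub> S' \<star>\<^bsub>length k\<^esub> V \<star>\<^bsub>length m\<^esub> A' \<star>\<^bsub>length m\<^esub> W
      = P \<star>\<^bsub>length k\<^esub> S' \<star>\<^bsub>length k\<^esub> (V \<star>\<^bsub>length m\<^esub> (A' \<star>\<^bsub>length m\<^esub> W))"
    unfolding einstein_prod_assoc[OF PSV A' W]
    by (rule einstein_prod_assoc[OF PS V dims_einstein_prod[OF A' W]])
  also have "\<dots> = P \<star>\<^bsub>length k\<^esub> S' \<star>\<^bsub>length k\<^esub> S \<star>\<^bsub>length k\<^esub> T"
    unfolding exchange by (rule einstein_prod_assoc[OF PS S T, symmetric])
  also have "\<dots> = Y"
    unfolding einstein_prod_assoc[OF P S' S] S'S einstein_prod_identity_right[OF P] Y_def ..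
  finally have "(A' - P \<star>\<^bsub>length k\<^esub> S' \<star>\<^bsub>length k\<^esub> V \<star>\<^bsub>length m\<^esub> A') \<star>\<^bsub>length m\<^esub> W
      = identity_tensor m + Y - Y"
    by (simp add: einstein_prod_diff_distrib_right[OF A' PSVA W] AW)
  then show ?thesis
    by (simp add: add_diff_cancel_tensor[OF identity_in_tensor_space Y] W_def P_def)
qed

theorem theorem3p1:
  fixes M K :: nat and I :: "nat \<Rightarrow> nat" and A B U V :: ctensor
  assumes "M \<ge> 1" and "K \<ge> 1"
    and "\<And>k. k \<ge> 1 \<Longrightarrow> I k > 0"
    and "A \<in> tensor_space (dims_upto I M @ dims_upto I M)"
    and "B \<in> tensor_space (dims_upto I K @ dims_upto I K)"
    and "invertible_tensor A" and "invertible_tensor B"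
    and "U \<in> tensor_space (dims_upto I M @ dims_upto I K)"
    and "V \<in> tensor_space (dims_upto I K @ dims_upto I M)"
    and "invertible_tensor (inverse_tensor B + V \<star>\<^bsub>M\<^esub> inverse_tensor A \<star>\<^bsub>M\<^esub> U)"
  shows "invertible_tensor (A + U \<star>\<^bsub>K\<^esub> B \<star>\<^bsub>K\<^esub> V) \<and>
    inverse_tensor (A + U \<star>\<^bsub>K\<^esub> B \<star>\<^bsub>K\<^esub> V) =
      inverse_tensor A - inverse_tensor A \<star>\<^bsub>M\<^esub> U
        \<star>\<^bsub>K\<^esub> inverse_tensor (inverse_tensor B + V \<star>\<^bsub>M\<^esub> inverse_tensor A \<star>\<^bsub>M\<^esub> U)
        \<star>\<^bsub>K\<^esub> V \<star>\<^bsub>M\<^esub> inverse_tensor A"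
proof -
  define m k where "m = dims_upto I M" and "k = dims_upto I K"
  have M: "M = length m" and K: "K = length k"
    by (simp_all add: m_def k_def dims_upto_def)
  note [folded m_def k_def] = assms(4,5,8,9)
  note A = this(1) and B = this(2) and U = this(3) and V = this(4)
  note A' = inverse_tensor_props[OF A assms(6)] and B' = inverse_tensor_props[OF B assms(7)]
  let ?S = "inverse_tensor B + V \<star>\<^bsub>length m\<^esub> inverse_tensor A \<star>\<^bsub>length m\<^esub> U"
  have "?S \<in> tensor_space (k @ k)"
    by (intro tensor_space_closed B'(1))
  note S' = inverse_tensor_props[OF this assms(10)[unfolded M]]
  let ?W = "A + U \<star>\<^bsub>length k\<^esub> B \<star>\<^bsub>length k\<^esub> V"
  let ?X = "inverse_tensor A - inverse_tensor A \<star>\<^bsub>length m\<^esub> U \<star>\<^bsub>length k\<^esub> inverse_tensor ?S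
    \<star>\<^bsub>length k\<^esub> V \<star>\<^bsub>length m\<^esub> inverse_tensor A"
  have W: "?W \<in> tensor_space (m @ m)"
    by (intro tensor_space_closed A)
  have "?X \<in> tensor_space (m @ m)"
    by (intro tensor_space_closed A'(1))
  moreover have "?W \<star>\<^bsub>length m\<^esub> ?X = identity_tensor m"
    by (rule woodbury_right[OF A A'(1) B B'(1) U V S'(1) A'(2) B'(2) S'(2)])
  moreover have "?X \<star>\<^bsub>length m\<^esub> ?W = identity_tensor m"
    by (rule woodbury_left[OF A A'(1) B B'(1) U V S'(1) A'(3) B'(3) S'(3)])
  ultimately have X: "is_inverse_tensor ?W ?X"
    by (simp add: is_inverse_tensor_iff[OF W])
  then have "invertible_tensor ?W"
    by (auto simp: invertible_tensor_def)
  moreover have "inverse_tensor ?W = ?X"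
    by (rule inverse_tensor_eqI[OF W X])
  ultimately show ?thesis
    unfolding M K ..
qed

end
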